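(* Every principal minor of the matrix $W=(t^{ij})_{0\le i,j<10}$ over the field $K=\mathbb{F}_7[X]/(\Phi_{10}(X))$ is nonzero; that is, $\det (t^{ij})_{i,j\in S}\neq 0$ in $K$ for every $S\subseteq\{0,1,\dots,9\}$.
   Context: Here $\Phi_{10}(X)=X^4-X^3+X^2-X+1$, $K=\mathbb{F}_7[X]/(\Phi_{10}(X))$ (a field with $7^4$ elements), and $t=X\bmod \Phi_{10}(X)\in K$ is the class of $X$. The determinant of the empty matrix ($S=\varnothing$) is $1$ by convention. *)

theory Defs
  imports
    "Berlekamp_Zassenhaus.Finite_Field"
    "Jordan_Normal_Form.Determinant"
    "Jordan_Normal_Form.DL_Submatrix"
begin

text \<open>
  The field with 7 elements is obtained as \<open>mod_ring\<close> over an index type with 7 elements. The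
  numeral type \<open>7\<close> cannot serve as the index: it is a compound type, so it cannot be declared an
  instance of \<open>prime_card\<close>, which is what makes \<open>mod_ring\<close> a field.
\<close>

typedef idx7 = "{0..<7::nat}"
  by (rule exI[of _ 0]) simp

lemma CARD_idx7 [simp]: "CARD(idx7) = 7"
  using type_definition.card[OF type_definition_idx7] by simp

instance idx7 :: prime_card
  by standard simp

type_synonym F7 = "idx7 mod_ring"

lemma CARD_F7: "CARD(F7) = 7"
  by simp

definition Phi10 :: "F7 poly" where
  "Phi10 = [:1, -1, 1, -1, 1:]"

lemma Phi10_eq_monom_sum:
  "Phi10 = monom 1 4 - monom 1 3 + monom 1 2 - monom 1 1 + 1"
  by (simp add: Phi10_def monom_altdef numeral_eq_Suc one_pCons)

lemma F7_cases:
  fixes x :: F7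
  shows "x = 0 \<or> x = 1 \<or> x = 2 \<or> x = 3 \<or> x = 4 \<or> x = 5 \<or> x = 6"
proof -
  obtain i where i: "i < CARD(idx7)" "x = of_nat i"
    using surj_of_nat_mod_ring[of x] by auto
  then have "i \<in> {0, 1, 2, 3, 4, 5, 6}" by auto
  with i show ?thesis by auto
qed

lemma F7_numeral_eq_0_iff: "(numeral n :: F7) = 0 \<longleftrightarrow> 7 dvd (numeral n :: nat)"
  by (metis CARD_idx7 of_nat_eq_0_iff_char_dvd of_nat_numeral semiring_char_mod_ring)

lemma F7_no_root:
  fixes x :: F7
  shows "x^4 - x^3 + x^2 - x + 1 \<noteq> 0"
  using F7_cases[of x] by (elim disjE) (simp_all add: F7_numeral_eq_0_iff)

lemma F7_no_quadratic:
  fixes a b c d :: F7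
  assumes "a + c = -1" and "b + d + a * c = 1" and "a * d + b * c = -1" and "b * d = 1"
  shows False
proof -
  have c: "c = -1 - a" using assms(1) by (simp add: algebra_simps)
  have d: "d = 1 - b - a * c" using assms(2) by (simp add: algebra_simps)
  have 1: "b * d - 1 = 0" using assms(4) by simp
  have 2: "a * d + b * c + 1 = 0" using assms(3) by simp
  show False
    using F7_cases[of a] F7_cases[of b] 1 2 unfolding d c
    by (elim disjE) (simp_all add: F7_numeral_eq_0_iff)
qed

lemma degree_Phi10: "degree Phi10 = 4"
  by (simp add: Phi10_def)

lemma Phi10_neq_0: "Phi10 \<noteq> 0"
  by (simp add: Phi10_def)

lemma Phi10_no_monic_divisor:
  fixes p :: "F7 poly"
  assumes dvd: "p dvd Phi10" and lc: "lead_coeff p = 1" and deg: "degree p = 1 \<or> degree p = 2"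
  shows False
  using deg
proof
  assume d: "degree p = 1"
  obtain a where p: "p = [:a, 1:]"
    using d lc by (metis One_nat_def coeff_pCons_0 coeff_pCons_Suc degree1_coeffs)
  have "poly Phi10 (- a) = 0"
    by (rule poly_eq_0_iff_dvd[THEN iffD2]) (use dvd p in simp)
  then have "(-a)^4 - (-a)^3 + (-a)^2 - (-a) + 1 = 0"
    unfolding Phi10_def
    by (simp add: algebra_simps numeral_eq_Suc)
  then show False
    using F7_no_root by blast
next
  assume d: "degree p = 2"
  obtain q where q: "Phi10 = p * q"
    using dvd by (auto simp: dvd_def)
  have "degree (p * q) = degree p + degree q"
    by (metis degree_mult_eq mult_eq_0_iff Phi10_neq_0 q)
  then have dq: "degree q = 2"
    using q d degree_Phi10 by simp
  have "lead_coeff Phi10 = 1"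
    by (simp add: Phi10_def)
  then have lq: "lead_coeff q = 1"
    using q lc by (metis lead_coeff_mult mult_1)
  obtain b a l0 where p0: "p = [:b, a, l0:]"
    by (rule degree2_coeffs[OF d])
  moreover have "l0 = 1"
    using lc d p0 by (simp add: numeral_2_eq_2)
  ultimately have p: "p = [:b, a, 1:]"
    by simp
  obtain e c l1 where q'0: "q = [:e, c, l1:]"
    by (rule degree2_coeffs[OF dq])
  moreover have "l1 = 1"
    using lq dq q'0 by (simp add: numeral_2_eq_2)
  ultimately have q': "q = [:e, c, 1:]"
    by simp
  have "[:1, -1, 1, -1, 1:] = [:b * e, a * e + b * c, b + e + a * c, a + c, 1:]"
  proof -
    have "p * q = [:b * e, a * e + b * c, b + e + a * c, a + c, 1:]"
      unfolding p q' by (simp add: algebra_simps)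
    then show ?thesis using q unfolding Phi10_def by (rule trans[rotated])
  qed
  then have "a + c = -1" "b + e + a * c = 1" "a * e + b * c = -1" "b * e = 1"
    by (metis pCons_eq_iff)+
  then show False
    by (rule F7_no_quadratic)
qed

lemma Phi10_no_divisor:
  fixes p :: "F7 poly"
  assumes dvd: "p dvd Phi10" and deg: "degree p = 1 \<or> degree p = 2"
  shows False
proof -
  let ?p = "smult (inverse (lead_coeff p)) p"
  have "p \<noteq> 0" using deg by auto
  then have "?p dvd Phi10" "lead_coeff ?p = 1" "degree ?p = 1 \<or> degree ?p = 2"
    using dvd deg by (auto simp: smult_dvd_iff)
  then show False
    by (rule Phi10_no_monic_divisor)
qed

lemma irreducible_Phi10: "irreducible Phi10"
proof (rule irreducibleI)
  show "Phi10 \<noteq> 0" by (rule Phi10_neq_0)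
  show "\<not> is_unit Phi10"
    using degree_Phi10 by (auto simp: is_unit_iff_degree Phi10_neq_0)
  fix p q assume pq: "Phi10 = p * q"
  then have nz: "p \<noteq> 0" "q \<noteq> 0" using Phi10_neq_0 by auto
  then have "degree p + degree q = 4"
    using pq degree_Phi10 by (metis degree_mult_eq)
  moreover have "degree p \<noteq> 1" "degree p \<noteq> 2" "degree q \<noteq> 1"
    using Phi10_no_divisor pq by (metis dvd_triv_left dvd_triv_right)+
  ultimately have "degree p = 0 \<or> degree q = 0"
    by presburger
  then show "is_unit p \<or> is_unit q"
    using nz by (auto simp: is_unit_iff_degree)
qed

text \<open>
  The quotient by the ideal generated by \<open>Phi10\<close>. Irreducibility of \<open>Phi10\<close> is used below for the
  field instance.
\<close>

quotient_type K = "F7 poly" / "\<lambda>p q. Phi10 dvd p - q"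
  morphisms rep_K abs_K
proof (rule equivpI)
  show "reflp (\<lambda>p q. Phi10 dvd p - q)"
    by (simp add: reflp_def)
  show "symp (\<lambda>p q. Phi10 dvd p - q)"
    by (simp add: symp_def dvd_diff_commute)
  show "transp (\<lambda>p q. Phi10 dvd p - q)"
    unfolding transp_def by (metis diff_add_cancel add_diff_eq dvd_add)
qed

instantiation K :: comm_ring_1
begin

lift_definition zero_K :: K is 0 .
lift_definition one_K :: K is 1 .
lift_definition plus_K :: "K \<Rightarrow> K \<Rightarrow> K" is "(+)"
  by (metis add_diff_add dvd_add)
lift_definition minus_K :: "K \<Rightarrow> K \<Rightarrow> K" is "(-)"
  by (metis diff_diff_eq2 diff_add_eq diff_diff_add add.commute dvd_diff)
lift_definition uminus_K :: "K \<Rightarrow> K" is uminus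
  by (metis minus_diff_minus dvd_minus_iff)
lift_definition times_K :: "K \<Rightarrow> K \<Rightarrow> K" is "(*)"
proof -
  fix p p' q q' :: "F7 poly"
  assume "Phi10 dvd p - p'" "Phi10 dvd q - q'"
  moreover have "p * q - p' * q' = (p - p') * q + p' * (q - q')"
    by (simp add: algebra_simps)
  ultimately show "Phi10 dvd p * q - p' * q'"
    by simp
qed

instance
proof
  show "(0::K) \<noteq> 1"
    by transfer (use degree_Phi10 in \<open>auto simp: is_unit_iff_degree Phi10_neq_0\<close>)
qed (transfer; simp add: algebra_simps)+

end

lift_definition t_K :: K is "[:0, 1:]" .

lemma K_inverse_exists:
  fixes x :: K
  assumes "x \<noteq> 0"
  shows "\<exists>y. y * x = 1"
  using assms
proof transfer
  fix p :: "F7 poly"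
  assume "\<not> Phi10 dvd p - 0"
  then have "coprime Phi10 p"
    using irreducible_Phi10 by (simp add: prime_elem_imp_coprime irreducible_imp_prime_elem)
  then obtain a b where ab: "a * Phi10 + b * p = 1"
    by (metis bezout_coefficients_fst_snd coprime_imp_gcd_eq_1)
  then have "b * p - 1 = Phi10 * (- a)"
    by (simp add: algebra_simps)
  then show "\<exists>y. Phi10 dvd y * p - 1"
    by (metis dvd_triv_left)
qed

instantiation K :: field
begin

definition inverse_K :: "K \<Rightarrow> K" where
  "inverse_K x = (if x = 0 then 0 else (SOME y. y * x = 1))"

definition divide_K :: "K \<Rightarrow> K \<Rightarrow> K" where
  "divide_K x y = x * inverse y"

instance
proof
  fix x y :: K
  show "inverse x * x = 1" if "x \<noteq> 0"
    using someI_ex[OF K_inverse_exists[OF that]] that by (simp add: inverse_K_def)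
  show "x div y = x * inverse y" by (rule divide_K_def)
  show "inverse (0::K) = 0" by (simp add: inverse_K_def)
qed

end

lemma CARD_K: "CARD(K) = 7 ^ 4"
proof -
  define f :: "F7 \<times> F7 \<times> F7 \<times> F7 \<Rightarrow> K" where "f = (\<lambda>(a, b, c, d). abs_K [:a, b, c, d:])"
  have "inj f"
  proof (rule injI)
    fix x y assume eq: "f x = f y"
    obtain a b c d a' b' c' d' where xy: "x = (a, b, c, d)" "y = (a', b', c', d')"
      by (metis surj_pair)
    let ?r = "[:a - a', b - b', c - c', d - d':]"
    have "Phi10 dvd ?r"
      using eq by (simp add: f_def xy K.abs_eq_iff)
    moreover have "degree ?r < degree Phi10"
      by (simp add: degree_Phi10)
    ultimately have "?r = 0"
      by (metis dvd_imp_degree_le not_less)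
    then show "x = y" by (simp add: xy)
  qed
  moreover have "surj f"
  proof (rule surjI)
    fix x :: K
    define r where "r = rep_K x mod Phi10"
    have "degree r < 4"
      using degree_mod_less'[of Phi10 "rep_K x"] degree_Phi10 Phi10_neq_0
      by (cases "r = 0") (auto simp: r_def)
    then have "r = [:coeff r 0, coeff r 1, coeff r 2, coeff r 3:]"
      by (auto simp: poly_eq_iff coeff_pCons coeff_eq_0 numeral_eq_Suc split: nat.split)
    moreover have "abs_K r = abs_K (rep_K x)"
      by (simp add: K.abs_eq_iff r_def mod_eq_dvd_iff[symmetric])
    ultimately show "f (let r = rep_K x mod Phi10 in (coeff r 0, coeff r 1, coeff r 2, coeff r 3)) = x"
      using Quotient_abs_rep[OF Quotient_K] by (simp add: f_def Let_def r_def)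
  qed
  ultimately have "CARD(K) = CARD(F7 \<times> F7 \<times> F7 \<times> F7)"
    by (metis bij_betw_same_card bij_betw_def)
  then show ?thesis by simp
qed

text \<open>
  \<open>submatrix W S S\<close> lists the elements of \<open>S\<close> in increasing order, so for \<open>S \<subseteq> {0..9}\<close> its
  determinant is the principal minor indexed by \<open>S\<close>. For empty \<open>S\<close> it is the 0 by 0 matrix, whose
  determinant is 1 (see \<open>det_submatrix_empty\<close>).
\<close>

definition W :: "K mat" where
  "W = mat 10 10 (\<lambda>(i, j). t_K ^ (i * j))"

lemma det_submatrix_empty: "det (submatrix W {} {}) = 1"
  by (simp add: submatrix_def det_def)

end

theory Submission
  imports Defs
begin

text \<open>
  A matrix has only nonzero principal minors if and only if its top left entry \<open>a\<close> is nonzero and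
  the matrix with first row and column deleted, as well as the Schur complement of \<open>a\<close> (here
  multiplied by \<open>a\<close> to avoid divisions), again have only nonzero principal minors. For \<open>W\<close> this
  recursion takes about 3000 operations in \<open>K\<close>, which are carried out on coordinates with respect
  to the basis \<open>1, t, t\<^sup>2, t\<^sup>3\<close>.
\<close>

section \<open>Principal minors by Schur complements\<close>

text \<open>A trivial kernel instead of a nonzero determinant: rows and columns stay indexed by the
  set itself, so no renumbering or expansion of determinants is needed in the induction.\<close>

definition nonsingular_on :: "nat set \<Rightarrow> (nat \<Rightarrow> nat \<Rightarrow> 'a::comm_ring_1) \<Rightarrow> bool" where
  "nonsingular_on S f \<longleftrightarrow>
    (\<forall>v. (\<forall>i\<in>S. (\<Sum>j\<in>S. f i j * v j) = 0) \<longrightarrow> (\<forall>j\<in>S. v j = 0))"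

lemma nonsingular_onD:
  assumes "nonsingular_on S f" "\<And>i. i \<in> S \<Longrightarrow> (\<Sum>j\<in>S. f i j * v j) = 0" "j \<in> S"
  shows "v j = 0"
  using assms unfolding nonsingular_on_def by blast

lemma nonsingular_on_Suc_image:
  assumes "nonsingular_on T (\<lambda>i j. f (Suc i) (Suc j))"
  shows "nonsingular_on (Suc ` T) f"
  unfolding nonsingular_on_def
proof (intro allI impI ballI)
  fix v j
  assume v: "\<forall>i\<in>Suc ` T. (\<Sum>j\<in>Suc ` T. f i j * v j) = 0" and "j \<in> Suc ` T"
  then obtain k where k: "j = Suc k" "k \<in> T" by blast
  have "v (Suc k) = 0"
  proof (rule nonsingular_onD[OF assms _ k(2)])
    fix i assume "i \<in> T"
    then show "(\<Sum>j\<in>T. f (Suc i) (Suc j) * v (Suc j)) = 0"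
      using v by (simp add: sum.reindex)
  qed
  then show "v j = 0" by (simp add: k)
qed

text \<open>Fraction-free elimination: \<open>f 0 0\<close> times row \<open>Suc i\<close> minus
  \<open>f (Suc i) 0\<close> times row 0 has no \<open>v 0\<close> term, so the tail of a kernel
  vector lies in the kernel of the scaled Schur complement and vanishes. Row 0 then reads
  \<open>f 0 0 * v 0 = 0\<close>.\<close>

lemma nonsingular_on_insert_0:
  fixes f :: "nat \<Rightarrow> nat \<Rightarrow> 'a::idom"
  assumes a: "f 0 0 \<noteq> 0" and T: "finite T"
    and schur: "nonsingular_on T (\<lambda>i j. f 0 0 * f (Suc i) (Suc j) - f (Suc i) 0 * f 0 (Suc j))"
  shows "nonsingular_on (insert 0 (Suc ` T)) f"
  unfolding nonsingular_on_def
proof (intro allI impI)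
  fix v
  assume v: "\<forall>i\<in>insert 0 (Suc ` T). (\<Sum>j\<in>insert 0 (Suc ` T). f i j * v j) = 0"
  have row: "f i 0 * v 0 + (\<Sum>j\<in>T. f i (Suc j) * v (Suc j)) = 0" if "i \<in> insert 0 (Suc ` T)" for i
    using v that T by (auto simp: sum.reindex)
  have tail: "v (Suc j) = 0" if "j \<in> T" for j
  proof (rule nonsingular_onD[OF schur _ that, where v = "\<lambda>j. v (Suc j)"])
    fix i assume "i \<in> T"
    \<comment> \<open>The two \<open>v 0\<close> terms on the right cancel; they complete the sums
      to full rows of the system.\<close>
    have "(\<Sum>j\<in>T. (f 0 0 * f (Suc i) (Suc j) - f (Suc i) 0 * f 0 (Suc j)) * v (Suc j))
        = f 0 0 * (f (Suc i) 0 * v 0 + (\<Sum>j\<in>T. f (Suc i) (Suc j) * v (Suc j)))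
          - f (Suc i) 0 * (f 0 0 * v 0 + (\<Sum>j\<in>T. f 0 (Suc j) * v (Suc j)))"
      by (simp add: algebra_simps sum_distrib_left sum_subtractf)
    also have "\<dots> = 0" using row \<open>i \<in> T\<close> by simp
    finally show "(\<Sum>j\<in>T. (f 0 0 * f (Suc i) (Suc j) - f (Suc i) 0 * f 0 (Suc j)) * v (Suc j)) = 0" .
  qed
  moreover have "v 0 = 0"
    using row[of 0] tail a by simp
  ultimately show "\<forall>j\<in>insert 0 (Suc ` T). v j = 0" by blast
qed

text \<open>The parameters are a test for being nonzero and the operation \<open>a * b - c * d\<close>.\<close>

fun schur_test ::
  "('a \<Rightarrow> bool) \<Rightarrow> ('a \<Rightarrow> 'a \<Rightarrow> 'a \<Rightarrow> 'a \<Rightarrow> 'a) \<Rightarrow> 'a list list \<Rightarrow> bool" where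
  "schur_test nz det2 [] = True"
| "schur_test nz det2 (r0 # rs) =
    (nz (hd r0) \<and>
     schur_test nz det2
       (map (\<lambda>r. map2 (\<lambda>b c. det2 (hd r0) b (hd r) c) (tl r) (tl r0)) rs) \<and>
     schur_test nz det2 (map tl rs))"

text \<open>Induction on the size, with \<open>f\<close> arbitrary because it turns into a Schur
  complement. Sets containing 0 are settled by the first recursive call and the others by the
  second, so one run covers all \<open>S\<close>.\<close>

lemma schur_test_nonsingular_on:
  fixes h :: "'a \<Rightarrow> 'b::idom"
  assumes nz: "\<And>a. nz a \<Longrightarrow> h a \<noteq> 0"
    and det2: "\<And>a b c d. h (det2 a b c d) = h a * h b - h c * h d"
    and "schur_test nz det2 M" and "\<forall>r\<in>set M. length r = length M"
    and "S \<subseteq> {..<length M}"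
    and "\<And>i j. i < length M \<Longrightarrow> j < length M \<Longrightarrow> f i j = h (M ! i ! j)"
  shows "nonsingular_on S f"
  using assms(3-)
proof (induction "length M" arbitrary: M S f)
  case 0
  then show ?case by (simp add: nonsingular_on_def)
next
  case (Suc n)
  then obtain r0 rs where M: "M = r0 # rs" by (cases M) auto
  define T where "T = {i. Suc i \<in> S}"
  have "k \<in> Suc ` T \<longleftrightarrow> k \<in> S - {0}" for k
    by (cases k) (auto simp: T_def)
  then have SucT: "Suc ` T = S - {0}" by blast
  have len: "length rs = n" "length r0 = Suc n" "\<And>r. r \<in> set rs \<Longrightarrow> length r = Suc n"
    using Suc.hyps(2) Suc.prems(2) by (auto simp: M)
  have T: "T \<subseteq> {..<n}"
    using Suc.prems(3) Suc.hyps(2) by (auto simp: T_def)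
  then have finT: "finite T"
    using finite_subset by blast
  have row_len: "length (rs ! i) = Suc n" if "i < n" for i
    using len that by simp
  have hd_nth: "hd xs = xs ! 0" if "length xs = Suc n" for xs :: "'a list"
    using that by (cases xs) auto
  have fM: "f i j = h ((r0 # rs) ! i ! j)" if "i \<le> n" "j \<le> n" for i j
    using Suc.prems(4)[of i j] that by (simp add: M len)
  \<comment> \<open>Corner, first column, first row and remaining block, in the
    \<open>hd\<close>/\<open>tl\<close> form of the recursive calls.\<close>
  have f: "f 0 0 = h (hd r0)"
    "\<And>i. i < n \<Longrightarrow> f (Suc i) 0 = h (hd (rs ! i))"
    "\<And>j. j < n \<Longrightarrow> f 0 (Suc j) = h (tl r0 ! j)"
    "\<And>i j. i < n \<Longrightarrow> j < n \<Longrightarrow> f (Suc i) (Suc j) = h (tl (rs ! i) ! j)"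
    by (simp_all add: fM hd_nth[OF len(2)] hd_nth[OF row_len] nth_tl len(2) row_len)
  show ?case
  proof (cases "0 \<in> S")
    case True
    have schur: "nonsingular_on T (\<lambda>i j. f 0 0 * f (Suc i) (Suc j) - f (Suc i) 0 * f 0 (Suc j))"
      by (rule Suc.hyps(1)[of
            "map (\<lambda>r. map2 (\<lambda>b c. det2 (hd r0) b (hd r) c) (tl r) (tl r0)) rs"])
        (use Suc.prems(1) len row_len T in \<open>auto simp: M f det2\<close>)
    have f00: "f 0 0 \<noteq> 0"
      using Suc.prems(1) nz by (simp add: M f(1))
    have "S = insert 0 (Suc ` T)"
      using True SucT by auto
    then show ?thesis
      using nonsingular_on_insert_0[OF f00 finT schur] by simp
  next
    case False
    have tails: "nonsingular_on T (\<lambda>i j. f (Suc i) (Suc j))"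
      by (rule Suc.hyps(1)[of "map tl rs"])
        (use Suc.prems(1) len T in \<open>auto simp: M f\<close>)
    have "S = Suc ` T"
      using False SucT by auto
    then show ?thesis
      using nonsingular_on_Suc_image[OF tails] by simp
  qed
qed

text \<open>If the determinant were zero, the submatrix would have a nonzero kernel vector;
  reindexed along \<open>pick S\<close>, it contradicts the trivial kernel on
  \<open>S\<close>.\<close>

lemma det_submatrix_nonzero:
  fixes A :: "'a::idom mat"
  assumes A: "A \<in> carrier_mat n n" and S: "S \<subseteq> {..<n}"
    and ns: "nonsingular_on S (\<lambda>i j. A $$ (i, j))"
  shows "det (submatrix A S S) \<noteq> 0"
proof
  have SA: "{i. i < n \<and> i \<in> S} = S" using S by blast
  have fin: "finite S" using S finite_subset by blast
  let ?B = "submatrix A S S"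
  have B: "?B \<in> carrier_mat (card S) (card S)"
    using A SA by (auto simp: submatrix_def)
  have bij: "bij_betw (pick S) {..<card S} S"
  proof (rule bij_betw_imageI)
    show "inj_on (pick S) {..<card S}"
      by (rule linorder_inj_onI) (auto dest: pick_mono_le)
    then show "pick S ` {..<card S} = S"
      using fin by (intro card_subset_eq) (auto simp: pick_in_set_le card_image)
  qed
  assume "det ?B = 0"
  then obtain v where v: "v \<in> carrier_vec (card S)" "v \<noteq> 0\<^sub>v (card S)" "?B *\<^sub>v v = 0\<^sub>v (card S)"
    using det_0_iff_vec_prod_zero[OF B] by blast
  \<comment> \<open>\<open>w\<close> is \<open>v\<close> with its positions renamed to elements of
    \<open>S\<close>; only its values on \<open>S\<close> enter the sums.\<close>
  define w where "w j = v $ (inv_into {..<card S} (pick S) j)" for j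
  have w: "w (pick S k) = v $ k" if "k < card S" for k
    using bij that by (simp add: w_def bij_betw_inv_into_left)
  have zero: "w j = 0" if "j \<in> S" for j
  proof (rule nonsingular_onD[OF ns _ that])
    fix i assume "i \<in> S"
    then obtain k where k: "k < card S" "i = pick S k"
      using bij by (auto simp: bij_betw_def)
    have "(\<Sum>j\<in>S. A $$ (i, j) * w j) = (\<Sum>l<card S. A $$ (pick S k, pick S l) * v $ l)"
      using k by (simp add: sum.reindex_bij_betw[OF bij, symmetric] w)
    also have "\<dots> = (?B *\<^sub>v v) $ k"
      using k v(1) A SA B
      by (auto simp: scalar_prod_def submatrix_index atLeast0LessThan intro!: sum.cong)
    also have "\<dots> = 0" using v(3) k by simp
    finally show "(\<Sum>j\<in>S. A $$ (i, j) * w j) = 0" .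
  qed
  have "v = 0\<^sub>v (card S)"
    using v(1) w zero bij
    by (intro eq_vecI)
      (metis bij_betwE index_zero_vec(1) lessThan_iff carrier_vecD index_zero_vec(2), simp)
  with v(2) show False by contradiction
qed

section \<open>Coordinates in K\<close>

type_synonym coords = "int \<times> int \<times> int \<times> int"

text \<open>Integers represent residues mod 7 so that the arithmetic can be evaluated; the
  representation is not unique, hence the reductions in \<open>elt_nz\<close>.\<close>

definition elt :: "coords \<Rightarrow> K" where
  "elt = (\<lambda>(a, b, c, d). of_int a + of_int b * t_K + of_int c * t_K ^ 2 + of_int d * t_K ^ 3)"

definition elt_nz :: "coords \<Rightarrow> bool" where
  "elt_nz = (\<lambda>(a, b, c, d). a mod 7 \<noteq> 0 \<or> b mod 7 \<noteq> 0 \<or> c mod 7 \<noteq> 0 \<or> d mod 7 \<noteq> 0)"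

text \<open>Reduction by \<open>t\<^sup>4 = t\<^sup>3 - t\<^sup>2 + t - 1\<close>, \<open>t\<^sup>5 = -1\<close> and \<open>t\<^sup>6 = -t\<close>.\<close>

definition elt_det2 :: "coords \<Rightarrow> coords \<Rightarrow> coords \<Rightarrow> coords \<Rightarrow> coords" where
  "elt_det2 = (\<lambda>(a0, a1, a2, a3) (b0, b1, b2, b3) (c0, c1, c2, c3) (d0, d1, d2, d3).
    let e = a1 * b3 + a2 * b2 + a3 * b1 - c1 * d3 - c2 * d2 - c3 * d1 in
    ((a0 * b0 - a2 * b3 - a3 * b2 - c0 * d0 + c2 * d3 + c3 * d2 - e) mod 7,
     (a0 * b1 + a1 * b0 - a3 * b3 - c0 * d1 - c1 * d0 + c3 * d3 + e) mod 7,
     (a0 * b2 + a1 * b1 + a2 * b0 - c0 * d2 - c1 * d1 - c2 * d0 - e) mod 7,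
     (a0 * b3 + a1 * b2 + a2 * b1 + a3 * b0 - c0 * d3 - c1 * d2 - c2 * d1 - c3 * d0 + e) mod 7))"

text \<open>The step is multiplication by \<open>t\<close>, with \<open>d * t^4\<close> rewritten as
  \<open>d * (t^3 - t^2 + t - 1)\<close>. As \<open>t^5 = -1\<close>, the coordinates stay in {-1,
  0, 1} without reduction mod 7.\<close>

primrec t_coords :: "nat \<Rightarrow> coords" where
  "t_coords 0 = (1, 0, 0, 0)"
| "t_coords (Suc n) = (case t_coords n of (a, b, c, d) \<Rightarrow> (- d, a + d, b - d, c + d))"

lemma of_int_F7_eq_0_iff: "(of_int a :: F7) = 0 \<longleftrightarrow> a mod 7 = 0"
  using of_int_eq_0_iff_char_dvd[where ?'a = F7, of a]
  by (simp add: semiring_char_mod_ring dvd_eq_mod_eq_0)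

lemma of_nat_K: "(of_nat n :: K) = abs_K [:of_nat n:]"
  by (induction n) (simp_all add: zero_K.abs_eq one_K.abs_eq plus_K.abs_eq one_pCons)

lemma of_int_K: "(of_int a :: K) = abs_K [:of_int a:]"
  by (cases a rule: int_diff_cases) (simp add: of_nat_K minus_K.abs_eq)

lemma of_int_mod_7_K: "(of_int (a mod 7) :: K) = of_int a"
proof -
  have "(of_int (a mod 7) :: F7) = of_int a"
    using of_int_F7_eq_0_iff[of "a mod 7 - a"] by (simp add: mod_diff_left_eq)
  then show ?thesis by (simp add: of_int_K)
qed

lemma t_K_power_4: "t_K ^ 4 = t_K ^ 3 - t_K ^ 2 + t_K - 1"
proof -
  have "t_K ^ 4 - t_K ^ 3 + t_K ^ 2 - t_K + 1 = abs_K Phi10"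
    by (simp add: numeral_eq_Suc t_K.abs_eq one_K.abs_eq times_K.abs_eq plus_K.abs_eq
        minus_K.abs_eq Phi10_def one_pCons)
  also have "\<dots> = 0"
    by (simp add: zero_K.abs_eq K.abs_eq_iff)
  finally show ?thesis by (simp add: algebra_simps)
qed

lemma elt_eq_abs_K: "elt (a, b, c, d) = abs_K [:of_int a, of_int b, of_int c, of_int d:]"
  by (simp add: elt_def numeral_eq_Suc t_K.abs_eq of_int_K times_K.abs_eq plus_K.abs_eq)

text \<open>Linear independence of 1, t, t^2, t^3 over \<open>F7\<close>: a nonzero polynomial of
  degree below 4 is not divisible by \<open>Phi10\<close>.\<close>

lemma elt_nz:
  assumes "elt_nz x"
  shows "elt x \<noteq> 0"
proof
  assume "elt x = 0"
  obtain a b c d where x: "x = (a, b, c, d)" by (metis surj_pair)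
  let ?p = "[:of_int a, of_int b, of_int c, of_int d:] :: F7 poly"
  have "Phi10 dvd ?p"
    using \<open>elt x = 0\<close> by (simp add: x elt_eq_abs_K zero_K.abs_eq K.abs_eq_iff)
  moreover have "degree ?p < degree Phi10"
    by (simp add: degree_Phi10)
  ultimately have "?p = 0"
    by (metis dvd_imp_degree_le not_less)
  then show False
    using assms by (simp add: x elt_nz_def of_int_F7_eq_0_iff)
qed

lemma cubic_mult:
  fixes t :: "'a::comm_ring_1"
  assumes t4: "t ^ 4 = t ^ 3 - t ^ 2 + t - 1"
  shows "(a0 + a1 * t + a2 * t ^ 2 + a3 * t ^ 3) * (b0 + b1 * t + b2 * t ^ 2 + b3 * t ^ 3) =
    (a0 * b0 - a2 * b3 - a3 * b2 - (a1 * b3 + a2 * b2 + a3 * b1))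
    + (a0 * b1 + a1 * b0 - a3 * b3 + (a1 * b3 + a2 * b2 + a3 * b1)) * t
    + (a0 * b2 + a1 * b1 + a2 * b0 - (a1 * b3 + a2 * b2 + a3 * b1)) * t ^ 2
    + (a0 * b3 + a1 * b2 + a2 * b1 + a3 * b0 + (a1 * b3 + a2 * b2 + a3 * b1)) * t ^ 3"
proof -
  \<comment> \<open>Multiplying the relation by \<open>t\<close> and substituting it once more
    collapses everything to -1, that is,
    \<open>(t + 1) * (t^4 - t^3 + t^2 - t + 1) = t^5 + 1\<close>.\<close>
  have "t ^ 5 = t * (t ^ 3 - t ^ 2 + t - 1)"
    unfolding t4[symmetric] by (simp add: numeral_eq_Suc)
  also have "\<dots> = t ^ 4 - t ^ 3 + t ^ 2 - t"
    by (simp add: algebra_simps numeral_eq_Suc)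
  finally have t5: "t ^ 5 = - 1"
    by (simp add: t4)
  have t6: "t ^ 6 = - t"
    using t5 by (simp add: numeral_eq_Suc)
  have "(a0 + a1 * t + a2 * t ^ 2 + a3 * t ^ 3) * (b0 + b1 * t + b2 * t ^ 2 + b3 * t ^ 3) =
      a0 * b0 + (a0 * b1 + a1 * b0) * t + (a0 * b2 + a1 * b1 + a2 * b0) * t ^ 2
      + (a0 * b3 + a1 * b2 + a2 * b1 + a3 * b0) * t ^ 3
      + (a1 * b3 + a2 * b2 + a3 * b1) * t ^ 4 + (a2 * b3 + a3 * b2) * t ^ 5 + a3 * b3 * t ^ 6"
    by (simp add: algebra_simps numeral_eq_Suc)
  then show ?thesis
    unfolding t4 t5 t6 by (simp add: algebra_simps)
qed

lemma elt_det2: "elt (elt_det2 x y z w) = elt x * elt y - elt z * elt w"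
  by (cases x; cases y; cases z; cases w)
    (simp add: elt_def elt_det2_def Let_def of_int_mod_7_K cubic_mult[OF t_K_power_4],
      simp add: algebra_simps)

lemma elt_t_coords: "elt (t_coords n) = t_K ^ n"
proof (induction n)
  case 0
  show ?case by (simp add: elt_def)
next
  case (Suc n)
  obtain a b c d where n: "t_coords n = (a, b, c, d)" by (metis surj_pair)
  have "elt (t_coords (Suc n)) = of_int d * (t_K ^ 3 - t_K ^ 2 + t_K - 1)
      + of_int a * t_K + of_int b * t_K ^ 2 + of_int c * t_K ^ 3"
    by (simp add: n elt_def algebra_simps)
  also have "\<dots> = t_K * elt (t_coords n)"
    unfolding t_K_power_4[symmetric] by (simp add: n elt_def algebra_simps numeral_eq_Suc)
  finally show ?case by (simp add: Suc)
qed

section \<open>Evaluation of the test for \<open>W\<close>\<close>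

definition W_coords :: "coords list list" where
  "W_coords = map (\<lambda>i. map (\<lambda>j. t_coords (i * j)) [0..<10]) [0..<10]"

text \<open>The evaluation checks 2^10 - 1 pivots, one for each nonempty \<open>S\<close>: keeping
  or deleting the indices below the largest element of \<open>S\<close> leads to its pivot.\<close>

lemma schur_test_W_coords: "schur_test elt_nz elt_det2 W_coords"
  by code_simp

theorem proposition3p1:
  shows "\<forall>S \<subseteq> {0..9}. det (submatrix W S S) \<noteq> 0"
proof (intro allI impI)
  fix S :: "nat set"
  assume "S \<subseteq> {0..9}"
  then have S: "S \<subseteq> {..<10}" by force
  have "nonsingular_on S (\<lambda>i j. W $$ (i, j))"
    by (rule schur_test_nonsingular_on[OF elt_nz elt_det2 schur_test_W_coords])
      (use S in \<open>auto simp: W_coords_def W_def elt_t_coords\<close>)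
  then show "det (submatrix W S S) \<noteq> 0"
    by (intro det_submatrix_nonzero[of _ 10]) (use S in \<open>auto simp: W_def\<close>)
qed

end
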